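(* Let $A$ be a uniform algebra on a compact Hausdorff space $X$ and let $S$ be its Šilov boundary. Let $E=\overline{\operatorname{Re}A|S}$ be the uniform closure of the real part $\operatorname{Re}A|S=\{\operatorname{Re}f|_S: f\in A\}$ of $A|S$. Then $E$ is a $C$-rich $\mathbb{R}$-linear subspace of $C(S,\mathbb{R})$.
   Context: $C(X,\mathbb{K})$ ($\mathbb{K}=\mathbb{R}$ or $\mathbb{C}$) is the Banach space of all $\mathbb{K}$-valued continuous functions on the compact Hausdorff space $X$ with the supremum norm. A uniform algebra on $X$ is a (uniformly) closed subalgebra of $C(X,\mathbb{C})$ which contains the constants and separates the points of $X$. A subset $L\subset X$ is a boundary for $A$ if for each $f\in A$ there is $x\in L$ with $|f(x)|=\|f\|_\infty$; the Šilov boundary for $A$ is the smallest closed boundary, i.e. a closed boundary contained in every closed boundary for $A$ (it exists for a uniform algebra). A closed $\mathbb{K}$-linear subspace $E$ of $C(K,\mathbb{K})$ ($K$ compact Hausdorff) is called $C$-rich if for every nonempty open subset $U$ of $K$ and every $\varepsilon>0$ there exists a positive (i.e. $\ge 0$ everywhere) function $h_\varepsilon\in C(K,\mathbb{R})$ of norm $1$ with support inside $U$ such that the distance from $h_\varepsilon$ to $E$ is less than $\varepsilon$. *)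

theory Defs
  imports "HOL-Analysis.Analysis"
begin

(* Spaces are topologies, so that C(S,R) for a closed subset S of X is just the instance
   K = subtopology X S. The class real_normed_field has, up to isomorphism, only the
   members real and complex, so 'k below is the scalar field R or C. *)

(* C(K,k) with the supremum metric. Its elements are extensional on topspace K (the value
   undefined is taken outside), which gives exactly one representative per function on K;
   this is why "restrict" appears below. Boundedness is automatic for compact K. *)
abbreviation C_metric :: "'a topology \<Rightarrow> ('a \<Rightarrow> 'k::real_normed_field) metric" where
  "C_metric K \<equiv> cfunspace K euclidean_metric"

abbreviation C_space :: "'a topology \<Rightarrow> ('a \<Rightarrow> 'k::real_normed_field) set" where
  "C_space K \<equiv> mspace (C_metric K)"

abbreviation C_topology :: "'a topology \<Rightarrow> ('a \<Rightarrow> 'k::real_normed_field) topology" where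
  "C_topology K \<equiv> mtopology_of (C_metric K)"

definition sup_norm :: "'a topology \<Rightarrow> ('a \<Rightarrow> 'k::real_normed_field) \<Rightarrow> real" where
  "sup_norm K f = (SUP x\<in>topspace K. norm (f x))"

definition C_subspace :: "'a topology \<Rightarrow> ('a \<Rightarrow> 'k::real_normed_field) set \<Rightarrow> bool" where
  "C_subspace K E \<longleftrightarrow>
     E \<subseteq> C_space K \<and>
     (\<lambda>x\<in>topspace K. 0) \<in> E \<and>
     (\<forall>f\<in>E. \<forall>g\<in>E. (\<lambda>x\<in>topspace K. f x + g x) \<in> E) \<and>
     (\<forall>c. \<forall>f\<in>E. (\<lambda>x\<in>topspace K. c * f x) \<in> E)"

definition uniform_algebra :: "'a topology \<Rightarrow> ('a \<Rightarrow> complex) set \<Rightarrow> bool" where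
  "uniform_algebra X A \<longleftrightarrow>
     C_subspace X A \<and>
     (\<forall>f\<in>A. \<forall>g\<in>A. (\<lambda>x\<in>topspace X. f x * g x) \<in> A) \<and>
     closedin (C_topology X) A \<and>
     (\<forall>c. (\<lambda>x\<in>topspace X. c) \<in> A) \<and>
     (\<forall>x\<in>topspace X. \<forall>y\<in>topspace X. x \<noteq> y \<longrightarrow> (\<exists>f\<in>A. f x \<noteq> f y))"

definition is_boundary :: "'a topology \<Rightarrow> ('a \<Rightarrow> complex) set \<Rightarrow> 'a set \<Rightarrow> bool" where
  "is_boundary X A L \<longleftrightarrow>
     L \<subseteq> topspace X \<and> (\<forall>f\<in>A. \<exists>x\<in>L. norm (f x) = sup_norm X f)"

definition is_Silov_boundary :: "'a topology \<Rightarrow> ('a \<Rightarrow> complex) set \<Rightarrow> 'a set \<Rightarrow> bool" where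
  "is_Silov_boundary X A S \<longleftrightarrow>
     closedin X S \<and> is_boundary X A S \<and>
     (\<forall>L. closedin X L \<and> is_boundary X A L \<longrightarrow> S \<subseteq> L)"

(* Distance from a point to a (nonempty) subset of C(K,k). *)
definition C_dist :: "'a topology \<Rightarrow> ('a \<Rightarrow> 'k::real_normed_field) \<Rightarrow> ('a \<Rightarrow> 'k) set \<Rightarrow> real" where
  "C_dist K f E = (INF g\<in>E. mdist (C_metric K) f g)"

definition C_support :: "'a topology \<Rightarrow> ('a \<Rightarrow> 'k::real_normed_field) \<Rightarrow> 'a set" where
  "C_support K f = K closure_of {x \<in> topspace K. f x \<noteq> 0}"

(* Used for compact Hausdorff K. The map of_real is the inclusion of C(K,R) in C(K,k). *)
definition C_rich :: "'a topology \<Rightarrow> ('a \<Rightarrow> 'k::real_normed_field) set \<Rightarrow> bool" where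
  "C_rich K E \<longleftrightarrow>
     C_subspace K E \<and> closedin (C_topology K) E \<and>
     (\<forall>U \<epsilon>. openin K U \<and> U \<noteq> {} \<and> \<epsilon> > 0 \<longrightarrow>
        (\<exists>h :: 'a \<Rightarrow> real. h \<in> C_space K \<and> (\<forall>x\<in>topspace K. h x \<ge> 0) \<and>
           sup_norm K h = 1 \<and> C_support K h \<subseteq> U \<and>
           C_dist K (\<lambda>x\<in>topspace K. of_real (h x)) E < \<epsilon>))"

definition Re_restriction :: "('a \<Rightarrow> complex) set \<Rightarrow> 'a set \<Rightarrow> ('a \<Rightarrow> real) set" where
  "Re_restriction A S = (\<lambda>f. \<lambda>x\<in>S. Re (f x)) ` A"

end

theory Submission
  imports Defs
begin

text \<open>
  Richness comes from the minimality of the Silov boundary \<open>S\<close>. If \<open>U\<close> is nonempty and open in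
  \<open>S\<close>, then \<open>S - U\<close> is closed and does not contain \<open>S\<close>, so it is not a boundary. Hence some
  \<open>f \<in> A\<close>, after scaling, satisfies \<open>\<bar>f\<bar> \<le> 1\<close> on \<open>S\<close>, takes the value \<open>1\<close> at a point \<open>a \<in> U\<close>, and by
  compactness stays below some \<open>r < 1\<close> in modulus on \<open>S - U\<close> (\<open>Silov_boundary_peak\<close>).

  The real part of \<open>f\<close> may be far from nonnegative, and not small off \<open>U\<close>. Both defects are removed by the
  holomorphic map \<open>z \<mapsto> \<delta> / (1 + \<delta> - z)\<close>: it sends the closed unit disc into itself and into the right
  half-plane, fixes \<open>1\<close>, and for small \<open>\<delta>\<close> is uniformly small on the disc of radius \<open>r\<close>. The
  partial sums of its power series converge uniformly on the closed unit disc (\<open>peak_map\<close>), so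
  \<open>u = Re (\<delta> / (1 + \<delta> - f))\<close> is a uniform limit on \<open>S\<close> of real parts of polynomials in \<open>f\<close>, which lie
  in \<open>A\<close>; moreover \<open>0 \<le> u \<le> 1\<close>, \<open>u a = 1\<close> and \<open>u < \<eta>\<close> on \<open>S - U\<close> (\<open>Silov_boundary_nonneg_peak\<close>).

  Finally \<open>h = max 0 (u - \<eta>) / (1 - \<eta>)\<close> is a continuous function of norm \<open>1\<close>, it
  differs from \<open>u\<close> by at most \<open>\<eta>\<close> (\<open>truncation\<close>), and its support lies in the closed set
  \<open>{u \<ge> \<eta>} \<subseteq> U\<close>. That the closure of \<open>Re A|S\<close> is a real linear subspace is the continuity of the
  vector space operations (\<open>C_subspace_closure_of\<close>).
\<close>

section \<open>Approximation in spaces of continuous functions\<close>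

lemma C_space_eq:
  assumes "compact_space K"
  shows "C_space K = {f \<in> extensional (topspace K). continuous_map K euclidean f}"
  using compactin_mspace_cfunspace[of K euclidean_metric] assms
  by (auto simp: compact_space_def)

lemma C_spaceI:
  assumes "compact_space K" "continuous_map K euclidean f"
  shows "(\<lambda>x\<in>topspace K. f x) \<in> C_space K"
  unfolding C_space_eq[OF assms(1)]
  using assms(2) by (auto intro: continuous_map_eq)

lemma C_space_continuous_map:
  "compact_space K \<Longrightarrow> f \<in> C_space K \<Longrightarrow> continuous_map K euclidean f"
  by simp

text \<open>
  This translates closure in the metric space into uniform approximation. The inequality is
  non-strict because a supremum of distances that are all smaller than \<open>e\<close> may equal \<open>e\<close>.
\<close>

lemma C_closure_iff:
  assumes "F \<subseteq> C_space K"
  shows "f \<in> C_topology K closure_of F \<longleftrightarrow>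
    f \<in> C_space K \<and> (\<forall>e>0. \<exists>g\<in>F. \<forall>x\<in>topspace K. dist (f x) (g x) \<le> e)"
proof -
  interpret M: Metric_space "C_space K" "mdist (C_metric K)"
    by (rule Metric_space_mspace_mdist)
  have le: "mdist (C_metric K) f g \<le> e \<longleftrightarrow> (\<forall>x\<in>topspace K. dist (f x) (g x) \<le> e)"
    if "f \<in> C_space K" "g \<in> F" "e > 0" for g e
  proof
    assume l: "mdist (C_metric K) f g \<le> e"
    show "\<forall>x\<in>topspace K. dist (f x) (g x) \<le> e"
      using mdist_cfunspace_imp_mdist_le[OF that(1) _ l] that(2) assms
      by (metis mdist_euclidean_metric subsetD)
  next
    assume "\<forall>x\<in>topspace K. dist (f x) (g x) \<le> e"
    then show "mdist (C_metric K) f g \<le> e"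
      using that(3) by (intro mdist_cfunspace_le) auto
  qed
  have "f \<in> C_topology K closure_of F \<longleftrightarrow>
    f \<in> C_space K \<and> (\<forall>e>0. \<exists>g\<in>F. f \<in> C_space K \<and> g \<in> C_space K \<and> mdist (C_metric K) f g \<le> e)"
    unfolding mtopology_of_def M.metric_closure_of_alt M.in_mcball by blast
  also have "\<dots> \<longleftrightarrow> f \<in> C_space K \<and> (\<forall>e>0. \<exists>g\<in>F. \<forall>x\<in>topspace K. dist (f x) (g x) \<le> e)"
    using le assms by (meson subsetD)
  finally show ?thesis .
qed

lemma C_subspace_closure_of:
  fixes F :: "('a \<Rightarrow> 'k::real_normed_field) set"
  assumes K: "compact_space K" and F: "C_subspace K F"
  shows "C_subspace K (C_topology K closure_of F)"
proof -
  have FC: "F \<subseteq> C_space K"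
    and zero: "(\<lambda>x\<in>topspace K. 0) \<in> F"
    and add: "\<And>f g. f \<in> F \<Longrightarrow> g \<in> F \<Longrightarrow> (\<lambda>x\<in>topspace K. f x + g x) \<in> F"
    and mult: "\<And>c f. f \<in> F \<Longrightarrow> (\<lambda>x\<in>topspace K. c * f x) \<in> F"
    using F unfolding C_subspace_def by blast+
  note iff = C_closure_iff[OF FC]
  show ?thesis
    unfolding C_subspace_def
  proof (intro conjI ballI allI)
    show "C_topology K closure_of F \<subseteq> C_space K"
      using iff by blast
    show "(\<lambda>x\<in>topspace K. 0) \<in> C_topology K closure_of F"
      unfolding iff using zero FC by (metis dist_self less_imp_le subsetD)
  next
    fix f g assume f: "f \<in> C_topology K closure_of F" and g: "g \<in> C_topology K closure_of F"
    have c: "continuous_map K euclidean (\<lambda>x. f x + g x)"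
      using f g K unfolding iff by (intro continuous_map_add C_space_continuous_map) auto
    show "(\<lambda>x\<in>topspace K. f x + g x) \<in> C_topology K closure_of F"
      unfolding iff
    proof (intro conjI allI impI C_spaceI K c)
      fix e :: real assume "e > 0"
      then have "e / 2 > 0" by simp
      then obtain f' g' where f': "f' \<in> F" "\<And>x. x \<in> topspace K \<Longrightarrow> dist (f x) (f' x) \<le> e / 2"
        and g': "g' \<in> F" "\<And>x. x \<in> topspace K \<Longrightarrow> dist (g x) (g' x) \<le> e / 2"
        using f g unfolding iff by metis
      show "\<exists>p\<in>F. \<forall>x\<in>topspace K. dist ((\<lambda>x\<in>topspace K. f x + g x) x) (p x) \<le> e"
      proof (intro bexI[OF _ add[OF f'(1) g'(1)]] ballI)
        fix x assume x: "x \<in> topspace K"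
        have "dist (f x + g x) (f' x + g' x) \<le> dist (f x) (f' x) + dist (g x) (g' x)"
          by (rule dist_triangle_add)
        then show "dist ((\<lambda>x\<in>topspace K. f x + g x) x) ((\<lambda>x\<in>topspace K. f' x + g' x) x) \<le> e"
          using f'(2)[OF x] g'(2)[OF x] x by simp
      qed
    qed
  next
    fix c f assume f: "f \<in> C_topology K closure_of F"
    have co: "continuous_map K euclidean (\<lambda>x. c * f x)"
      using f K continuous_map_compose[OF C_space_continuous_map, of K f euclidean "(*) c"]
      unfolding iff by (auto simp: o_def intro: continuous_intros)
    show "(\<lambda>x\<in>topspace K. c * f x) \<in> C_topology K closure_of F"
      unfolding iff
    proof (intro conjI allI impI C_spaceI K co)
      fix e :: real assume "e > 0"
      \<comment> \<open>Adding \<open>1\<close> avoids a division by zero when \<open>c = 0\<close>.\<close>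
      then have "e / (norm c + 1) > 0" by (simp add: add_nonneg_pos)
      then obtain f' where f': "f' \<in> F" "\<And>x. x \<in> topspace K \<Longrightarrow> dist (f x) (f' x) \<le> e / (norm c + 1)"
        using f unfolding iff by metis
      show "\<exists>p\<in>F. \<forall>x\<in>topspace K. dist ((\<lambda>x\<in>topspace K. c * f x) x) (p x) \<le> e"
      proof (intro bexI[OF _ mult[OF f'(1)]] ballI)
        fix x assume x: "x \<in> topspace K"
        have "dist (c * f x) (c * f' x) = norm c * dist (f x) (f' x)"
          by (metis dist_norm norm_mult right_diff_distrib)
        also have "\<dots> \<le> (norm c + 1) * (e / (norm c + 1))"
          using f'(2)[OF x] by (intro mult_mono) auto
        also have "\<dots> = e"
          by (simp add: add_nonneg_pos[THEN less_imp_neq] add_nonneg_eq_0_iff)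
        finally show "dist ((\<lambda>x\<in>topspace K. c * f x) x) ((\<lambda>x\<in>topspace K. c * f' x) x) \<le> e"
          using x by simp
      qed
    qed
  qed
qed

lemma C_dist_le:
  assumes "g \<in> F" "0 \<le> B" "\<And>x. x \<in> topspace K \<Longrightarrow> dist (f x) (g x) \<le> B"
  shows "C_dist K f F \<le> B"
proof -
  have "C_dist K f F \<le> mdist (C_metric K) f g"
    unfolding C_dist_def
    by (rule cINF_lower[OF _ assms(1)]) (auto intro!: bdd_belowI[of _ 0])
  also have "\<dots> \<le> B"
    using assms by (intro mdist_cfunspace_le) auto
  finally show ?thesis .
qed

lemma norm_le_sup_norm:
  assumes "f \<in> C_space K" "x \<in> topspace K"
  shows "norm (f x) \<le> sup_norm K f"
  unfolding sup_norm_def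
proof (rule cSUP_upper[OF assms(2)])
  have "bounded (f ` topspace K)"
    using assms(1) by simp
  then show "bdd_above ((\<lambda>x. norm (f x)) ` topspace K)"
    unfolding bounded_iff bdd_above_def by auto
qed

lemma sup_norm_eqI:
  assumes "x \<in> topspace K" "norm (f x) = B" "\<And>y. y \<in> topspace K \<Longrightarrow> norm (f y) \<le> B"
  shows "sup_norm K f = B"
  unfolding sup_norm_def using assms by (intro cSup_eq_maximum) auto

lemma C_subspace_Re_restriction:
  assumes X: "compact_space X" and S: "closedin X S" and A: "C_subspace X A"
  shows "C_subspace (subtopology X S) (Re_restriction A S)"
proof -
  have ts: "topspace (subtopology X S) = S"
    using closedin_subset[OF S] by auto
  have cs: "compact_space (subtopology X S)"
    using X S by (simp add: closedin_compact_space compact_space_subtopology)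
  have SX: "S \<subseteq> topspace X"
    using S by (rule closedin_subset)
  have AC: "A \<subseteq> C_space X"
    and zero: "(\<lambda>x\<in>topspace X. 0) \<in> A"
    and add: "\<And>f g. f \<in> A \<Longrightarrow> g \<in> A \<Longrightarrow> (\<lambda>x\<in>topspace X. f x + g x) \<in> A"
    and mult: "\<And>c f. f \<in> A \<Longrightarrow> (\<lambda>x\<in>topspace X. c * f x) \<in> A"
    using A unfolding C_subspace_def by blast+
  show ?thesis
    unfolding C_subspace_def
  proof (intro conjI ballI allI subsetI)
    fix u assume "u \<in> Re_restriction A S"
    then obtain f where f: "f \<in> A" "u = (\<lambda>x\<in>S. Re (f x))"
      by (auto simp: Re_restriction_def)
    then have "continuous_map X euclidean f" using AC X by (intro C_space_continuous_map) auto
    then have "continuous_map (subtopology X S) euclidean (Re \<circ> f)"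
      by (intro continuous_map_from_subtopology continuous_map_compose[where X' = euclidean])
        (auto intro: continuous_intros)
    from C_spaceI[OF cs this] show "u \<in> C_space (subtopology X S)"
      unfolding f(2) ts by (simp only: o_def)
  next
    have "(\<lambda>x\<in>S. Re ((\<lambda>x\<in>topspace X. 0) x)) \<in> Re_restriction A S"
      unfolding Re_restriction_def using zero by (rule imageI)
    also have "(\<lambda>x\<in>S. Re ((\<lambda>x\<in>topspace X. 0) x)) = (\<lambda>x\<in>S. 0)"
      using SX by (intro restrict_ext) auto
    finally show "(\<lambda>x\<in>topspace (subtopology X S). 0) \<in> Re_restriction A S"
      unfolding ts .
  next
    fix u v assume "u \<in> Re_restriction A S" "v \<in> Re_restriction A S"
    then obtain f g where f: "f \<in> A" "u = (\<lambda>x\<in>S. Re (f x))" and g: "g \<in> A" "v = (\<lambda>x\<in>S. Re (g x))"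
      by (auto simp: Re_restriction_def)
    have "(\<lambda>x\<in>S. Re ((\<lambda>x\<in>topspace X. f x + g x) x)) \<in> Re_restriction A S"
      unfolding Re_restriction_def using add[OF f(1) g(1)] by (rule imageI)
    also have "(\<lambda>x\<in>S. Re ((\<lambda>x\<in>topspace X. f x + g x) x)) = (\<lambda>x\<in>S. u x + v x)"
      using SX f(2) g(2) by (intro restrict_ext) auto
    finally show "(\<lambda>x\<in>topspace (subtopology X S). u x + v x) \<in> Re_restriction A S"
      unfolding ts .
  next
    fix c u assume "u \<in> Re_restriction A S"
    then obtain f where f: "f \<in> A" "u = (\<lambda>x\<in>S. Re (f x))"
      by (auto simp: Re_restriction_def)
    have "(\<lambda>x\<in>S. Re ((\<lambda>x\<in>topspace X. complex_of_real c * f x) x)) \<in> Re_restriction A S"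
      unfolding Re_restriction_def using mult[OF f(1)] by (rule imageI)
    also have "(\<lambda>x\<in>S. Re ((\<lambda>x\<in>topspace X. complex_of_real c * f x) x)) = (\<lambda>x\<in>S. c * u x)"
      using SX f(2) by (intro restrict_ext) auto
    finally show "(\<lambda>x\<in>topspace (subtopology X S). c * u x) \<in> Re_restriction A S"
      unfolding ts .
  qed
qed

section \<open>Polynomials in an element of the algebra\<close>

lemma uniform_algebra_polynomial:
  assumes A: "uniform_algebra X A" and f: "f \<in> A"
  shows "(\<lambda>x\<in>topspace X. \<Sum>k<n. c k * f x ^ k) \<in> A"
proof -
  have zero: "(\<lambda>x\<in>topspace X. 0) \<in> A"
    and const: "\<And>c. (\<lambda>x\<in>topspace X. c) \<in> A"
    and add: "\<And>f g. f \<in> A \<Longrightarrow> g \<in> A \<Longrightarrow> (\<lambda>x\<in>topspace X. f x + g x) \<in> A"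
    and times: "\<And>f g. f \<in> A \<Longrightarrow> g \<in> A \<Longrightarrow> (\<lambda>x\<in>topspace X. f x * g x) \<in> A"
    using A unfolding uniform_algebra_def C_subspace_def by blast+
  have pow: "(\<lambda>x\<in>topspace X. c * f x ^ k) \<in> A" for c k
  proof (induction k)
    case 0
    then show ?case using const[of c] by (simp only: power_0 mult_1_right)
  next
    case (Suc k)
    have eq: "(\<lambda>x\<in>topspace X. c * f x ^ Suc k) = (\<lambda>x\<in>topspace X. (\<lambda>x\<in>topspace X. c * f x ^ k) x * f x)"
      by (intro restrict_ext) simp
    show ?case
      unfolding eq by (rule times[OF Suc f])
  qed
  show ?thesis
  proof (induction n)
    case 0
    show ?case using zero by (simp only: lessThan_0 sum.empty)
  next
    case (Suc n)
    have eq: "(\<lambda>x\<in>topspace X. \<Sum>k<Suc n. c k * f x ^ k) =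
        (\<lambda>x\<in>topspace X. (\<lambda>x\<in>topspace X. \<Sum>k<n. c k * f x ^ k) x + (\<lambda>x\<in>topspace X. c n * f x ^ n) x)"
      by (intro restrict_ext) simp
    show ?case
      unfolding eq by (rule add[OF Suc pow])
  qed
qed

section \<open>Functions that peak in an open subset of the Silov boundary\<close>

text \<open>
  Since \<open>S - U\<close> is not a boundary, the modulus of some function of the algebra does not
  attain its maximum there; its maximum is attained on \<open>S\<close>, hence at a point of \<open>U\<close>, and dividing by the
  value at this point gives \<open>f\<close>. The bound \<open>r\<close> is the maximum of \<open>\<bar>f\<bar>\<close> on the compact set \<open>S - U\<close>.
\<close>

lemma Silov_boundary_peak:
  assumes X: "compact_space X" and A: "uniform_algebra X A" and S: "is_Silov_boundary X A S"
    and U: "openin (subtopology X S) U" "U \<noteq> {}"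
  obtains f a r where "f \<in> A" "a \<in> S" "f a = 1" "r < 1"
    "\<And>x. x \<in> S \<Longrightarrow> norm (f x) \<le> 1"
    "\<And>x. x \<in> S - U \<Longrightarrow> norm (f x) \<le> r"
proof -
  have Sc: "closedin X S" and Sb: "is_boundary X A S"
    using S by (auto simp: is_Silov_boundary_def)
  have SX: "S \<subseteq> topspace X"
    using Sc by (rule closedin_subset)
  have US: "U \<subseteq> S"
    using openin_subset[OF U(1)] by simp
  have AC: "A \<subseteq> C_space X" and const: "\<And>c. (\<lambda>x\<in>topspace X. c) \<in> A"
    and mult: "\<And>c f. f \<in> A \<Longrightarrow> (\<lambda>x\<in>topspace X. c * f x) \<in> A"
    using A by (auto simp: uniform_algebra_def C_subspace_def)
  show thesis
  proof (cases "S - U = {}")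
    case True
    \<comment> \<open>The function that shows that the empty set is no boundary may vanish and then cannot be
      normalised; the constant \<open>1\<close> serves instead.\<close>
    obtain a where "a \<in> S" using U(2) US by blast
    then show thesis
      using const[of 1] True SX by (intro that[of "\<lambda>x\<in>topspace X. 1" a 0]) auto
  next
    case False
    have "closedin (subtopology X S) (S - U)"
      using U(1) SX by (metis closedin_def closedin_diff closedin_topspace topspace_subtopology_subset)
    then have cl: "closedin X (S - U)"
      using Sc by (rule closedin_trans_full)
    have "\<not> S \<subseteq> S - U" using U(2) US by blast
    then have "\<not> is_boundary X A (S - U)"
      using S cl unfolding is_Silov_boundary_def by blast
    then obtain g where g: "g \<in> A" "\<And>x. x \<in> S - U \<Longrightarrow> norm (g x) \<noteq> sup_norm X g"
      using SX unfolding is_boundary_def by blast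
    define s where "s = sup_norm X g"
    have le: "norm (g x) \<le> s" if "x \<in> topspace X" for x
      unfolding s_def using g(1) AC that by (intro norm_le_sup_norm) auto
    obtain b where b: "b \<in> S" "norm (g b) = s"
      using Sb g(1) unfolding is_boundary_def s_def by blast
    have "continuous_map X euclidean g"
      using g(1) AC X by (intro C_space_continuous_map) auto
    then have "continuous_map X euclideanreal (norm \<circ> g)"
      by (rule continuous_map_compose) (auto intro: continuous_intros)
    then have "compactin euclidean ((norm \<circ> g) ` (S - U))"
      using closedin_compact_space[OF X cl] by (intro image_compactin)
    then have "compact ((norm \<circ> g) ` (S - U))" by simp
    from compact_attains_sup[OF this] False
    obtain c where c: "c \<in> S - U" "\<And>x. x \<in> S - U \<Longrightarrow> norm (g x) \<le> norm (g c)"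
      by auto
    have lt: "norm (g c) < s"
      using le[of c] g(2)[OF c(1)] c(1) SX unfolding s_def by force
    then have s: "s > 0" by (metis norm_ge_zero le_less_trans)
    show thesis
    proof (rule that[of "\<lambda>x\<in>topspace X. inverse (g b) * g x" b "norm (g c) / s"])
      show "(\<lambda>x\<in>topspace X. inverse (g b) * g x) \<in> A" by (rule mult[OF g(1)])
      show "b \<in> S" by (rule b(1))
      show "(\<lambda>x\<in>topspace X. inverse (g b) * g x) b = 1"
        using b s SX by auto
      show "norm (g c) / s < 1" using lt s by simp
      show "norm ((\<lambda>x\<in>topspace X. inverse (g b) * g x) x) \<le> 1" if "x \<in> S" for x
        using that SX le[of x] b s by (auto simp: norm_mult norm_divide norm_inverse divide_simps)
      show "norm ((\<lambda>x\<in>topspace X. inverse (g b) * g x) x) \<le> norm (g c) / s" if "x \<in> S - U" for x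
        using that SX c(2)[of x] b s by (auto simp: norm_mult norm_divide norm_inverse divide_simps)
    qed
  qed
qed

text \<open>
  The denominator \<open>1 + \<delta> - z\<close> has positive real part and modulus at least \<open>1 + \<delta> - \<bar>z\<bar> \<ge> \<delta>\<close>, which
  gives the first three bounds. The sum in the last one is geometric with ratio \<open>t = z / (1 + \<delta>)\<close>, so its
  remainder is \<open>w * t ^ n\<close>.
\<close>

lemma peak_map:
  fixes z :: complex and \<delta> :: real
  assumes z: "norm z \<le> 1" and \<delta>: "\<delta> > 0"
  defines "w \<equiv> of_real \<delta> / (of_real (1 + \<delta>) - z)"
  shows "0 \<le> Re w" "norm w \<le> \<delta> / (1 + \<delta> - norm z)" "norm w \<le> 1"
    and "norm ((\<Sum>k<n. of_real (\<delta> / (1 + \<delta>) ^ Suc k) * z ^ k) - w) \<le> (1 / (1 + \<delta>)) ^ n"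
proof -
  define q where "q = of_real (1 + \<delta>) - z"
  have tri: "1 + \<delta> - norm z \<le> norm q"
    unfolding q_def using norm_triangle_ineq2[of "of_real (1 + \<delta>)" z] \<delta>
    unfolding norm_of_real by simp
  have q0: "q \<noteq> 0" using tri z \<delta> by auto
  have "Re q \<ge> 0"
    unfolding q_def using z \<delta> complex_Re_le_cmod[of z] by simp
  then show "0 \<le> Re w"
    unfolding w_def q_def[symmetric] Re_divide using \<delta> by simp
  show le: "norm w \<le> \<delta> / (1 + \<delta> - norm z)"
    unfolding w_def q_def[symmetric] norm_divide
    using tri z \<delta> by (auto intro!: divide_left_mono mult_pos_pos)
  also have "\<dots> \<le> 1" using z \<delta> by simp
  finally show w1: "norm w \<le> 1" .
  define t where "t = z / of_real (1 + \<delta>)"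
  have d0: "complex_of_real (1 + \<delta>) \<noteq> 0" using \<delta> by (metis of_real_eq_0_iff add_pos_pos less_irrefl zero_less_one)
  have qt: "q = of_real (1 + \<delta>) * (1 - t)"
    unfolding q_def t_def using d0 by (simp add: right_diff_distrib)
  have t1: "1 - t \<noteq> 0" using q0 qt by auto
  have "(\<Sum>k<n. of_real (\<delta> / (1 + \<delta>) ^ Suc k) * z ^ k) = (\<Sum>k<n. of_real (\<delta> / (1 + \<delta>)) * t ^ k)"
    by (intro sum.cong) (auto simp: t_def power_divide)
  also have "\<dots> = of_real (\<delta> / (1 + \<delta>)) * (\<Sum>k<n. t ^ k)"
    by (simp add: sum_distrib_left)
  also have "\<dots> = of_real (\<delta> / (1 + \<delta>)) * ((1 - t ^ n) / (1 - t))"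
    using t1 by (subst sum_gp_strict) auto
  also have "\<dots> = w * (1 - t ^ n)"
    unfolding w_def q_def[symmetric] qt by simp
  finally have "(\<Sum>k<n. of_real (\<delta> / (1 + \<delta>) ^ Suc k) * z ^ k) - w = - (w * t ^ n)"
    by (simp add: algebra_simps)
  then have "norm ((\<Sum>k<n. of_real (\<delta> / (1 + \<delta>) ^ Suc k) * z ^ k) - w) = norm w * norm t ^ n"
    by (simp only: norm_minus_cancel norm_mult norm_power)
  also have "\<dots> \<le> 1 * (1 / (1 + \<delta>)) ^ n"
  proof (intro mult_mono power_mono w1)
    show "norm t \<le> 1 / (1 + \<delta>)"
      unfolding t_def norm_divide norm_of_real using z \<delta> by (simp add: divide_right_mono)
  qed (use \<delta> in auto)
  finally show "norm ((\<Sum>k<n. of_real (\<delta> / (1 + \<delta>) ^ Suc k) * z ^ k) - w) \<le> (1 / (1 + \<delta>)) ^ n"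
    by simp
qed

text \<open>
  Here \<open>u\<close> is the exact image of a peaking function under the map of \<open>peak_map\<close>, and \<open>p\<close> is a partial sum
  of its power series. Keeping both gives exact bounds for \<open>u\<close> and membership of \<open>p\<close> in the algebra.
\<close>

lemma Silov_boundary_nonneg_peak:
  assumes X: "compact_space X" and A: "uniform_algebra X A" and S: "is_Silov_boundary X A S"
    and U: "openin (subtopology X S) U" "U \<noteq> {}" and \<eta>: "\<eta> > 0"
  obtains u a p where "continuous_map (subtopology X S) euclideanreal u" "a \<in> S" "u a = 1"
    "\<And>x. x \<in> S \<Longrightarrow> 0 \<le> u x \<and> u x \<le> 1"
    "\<And>x. x \<in> S - U \<Longrightarrow> u x < \<eta>"
    "p \<in> A" "\<And>x. x \<in> S \<Longrightarrow> \<bar>u x - Re (p x)\<bar> < \<eta>"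
proof -
  obtain f a r where f: "f \<in> A" and a: "a \<in> S" "f a = 1" and r: "r < 1"
    and f1: "\<And>x. x \<in> S \<Longrightarrow> norm (f x) \<le> 1"
    and fr: "\<And>x. x \<in> S - U \<Longrightarrow> norm (f x) \<le> r"
    using Silov_boundary_peak[OF X A S U] by blast
  have SX: "S \<subseteq> topspace X"
    using S closedin_subset unfolding is_Silov_boundary_def by blast
  have fC: "f \<in> C_space X"
    using A f unfolding uniform_algebra_def C_subspace_def by (meson subsetD)
  \<comment> \<open>With this \<open>\<delta>\<close> the bound \<open>\<delta> / (1 + \<delta> - r)\<close> on \<open>S - U\<close> is smaller than \<open>\<delta> / (1 - r) = \<eta>\<close>.\<close>
  define \<delta> where "\<delta> = \<eta> * (1 - r)"
  have \<delta>: "\<delta> > 0" using \<eta> r by (simp add: \<delta>_def)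
  define w where "w x = of_real \<delta> / (of_real (1 + \<delta>) - f x)" for x
  have nz: "f x \<noteq> of_real (1 + \<delta>)" if "x \<in> S" for x
  proof
    assume "f x = of_real (1 + \<delta>)"
    then have "norm (f x) = 1 + \<delta>" using \<delta> by (simp only: norm_of_real)
    then show False using f1[OF that] \<delta> by simp
  qed
  have "1 / (1 + \<delta>) < 1" using \<delta> by simp
  then obtain n where n: "(1 / (1 + \<delta>)) ^ n < \<eta>"
    using real_arch_pow_inv \<eta> by blast
  define p where "p = (\<lambda>x\<in>topspace X. \<Sum>k<n. of_real (\<delta> / (1 + \<delta>) ^ Suc k) * f x ^ k)"
  show thesis
  proof (rule that[of "\<lambda>x. Re (w x)" a p])
    have "continuous_map (subtopology X S) (top_of_set (- {of_real (1 + \<delta>)})) f"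
      unfolding continuous_map_in_subtopology
    proof
      show "continuous_map (subtopology X S) euclidean f"
        by (rule continuous_map_from_subtopology[OF C_space_continuous_map[OF X fC]])
      show "f \<in> topspace (subtopology X S) \<rightarrow> - {of_real (1 + \<delta>)}"
        using nz by simp
    qed
    then have "continuous_map (subtopology X S) euclidean
        ((\<lambda>z. Re (of_real \<delta> / (of_real (1 + \<delta>) - z))) \<circ> f)"
      by (rule continuous_map_compose) (auto intro!: continuous_intros)
    then show "continuous_map (subtopology X S) euclideanreal (\<lambda>x. Re (w x))"
      by (simp add: w_def o_def)
    show "a \<in> S" by (rule a(1))
    show "Re (w a) = 1" using a(2) \<delta> by (simp add: w_def)
    show "0 \<le> Re (w x) \<and> Re (w x) \<le> 1" if "x \<in> S" for x
      using peak_map(1,3)[OF f1[OF that] \<delta>] complex_Re_le_cmod[of "w x"] unfolding w_def by linarith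
    show "Re (w x) < \<eta>" if x: "x \<in> S - U" for x
    proof -
      have "Re (w x) \<le> \<delta> / (1 + \<delta> - norm (f x))"
        using peak_map(2)[OF f1 \<delta>, of x] complex_Re_le_cmod[of "w x"] x unfolding w_def by force
      also have "\<dots> \<le> \<delta> / (1 + \<delta> - r)"
        using fr[OF x] r \<delta> by (intro divide_left_mono mult_pos_pos) auto
      also have "\<dots> < \<delta> / (1 - r)"
        using r \<delta> by (intro divide_strict_left_mono mult_pos_pos) auto
      also have "\<dots> = \<eta>" using r by (simp add: \<delta>_def)
      finally show ?thesis .
    qed
    show "p \<in> A"
      unfolding p_def by (rule uniform_algebra_polynomial[OF A f])
    show "\<bar>Re (w x) - Re (p x)\<bar> < \<eta>" if x: "x \<in> S" for x
    proof -
      have "\<bar>Re (w x) - Re (p x)\<bar> \<le> norm (p x - w x)"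
        using abs_Re_le_cmod[of "p x - w x"] by (simp add: abs_minus_commute)
      also have "\<dots> \<le> (1 / (1 + \<delta>)) ^ n"
        using peak_map(4)[OF f1[OF x] \<delta>, of n] x SX by (auto simp: p_def w_def)
      finally show ?thesis using n by linarith
    qed
  qed
qed

section \<open>Truncation to a function supported in the open set\<close>

text \<open>
  The rescaling by \<open>1 - \<eta>\<close> keeps the value \<open>1\<close> at \<open>u = 1\<close>. It does not worsen the error \<open>\<eta>\<close> of the
  truncation: for \<open>u > \<eta>\<close> the error is \<open>\<eta> * (1 - u) / (1 - \<eta>)\<close>.
\<close>

lemma truncation:
  fixes u \<eta> :: real
  assumes "0 \<le> u" "u \<le> 1" "0 < \<eta>" "\<eta> < 1"
  shows "0 \<le> max 0 (u - \<eta>) / (1 - \<eta>)" "max 0 (u - \<eta>) / (1 - \<eta>) \<le> 1"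
    "\<bar>max 0 (u - \<eta>) / (1 - \<eta>) - u\<bar> \<le> \<eta>"
proof -
  show "0 \<le> max 0 (u - \<eta>) / (1 - \<eta>)" "max 0 (u - \<eta>) / (1 - \<eta>) \<le> 1"
    using assms by auto
  show "\<bar>max 0 (u - \<eta>) / (1 - \<eta>) - u\<bar> \<le> \<eta>"
  proof (cases "u \<le> \<eta>")
    case True
    then show ?thesis using assms by (simp add: max_def)
  next
    case False
    then have "max 0 (u - \<eta>) / (1 - \<eta>) - u = - \<eta> * ((1 - u) / (1 - \<eta>))"
      using assms by (simp add: max_def field_simps)
    then have "\<bar>max 0 (u - \<eta>) / (1 - \<eta>) - u\<bar> = \<eta> * ((1 - u) / (1 - \<eta>))"
      using assms by (simp add: abs_mult)
    also have "\<dots> \<le> \<eta> * 1"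
      using assms False by (intro mult_left_mono) auto
    finally show ?thesis by simp
  qed
qed

theorem proposition2p3:
  fixes X :: "'a topology" and A :: "('a \<Rightarrow> complex) set" and S :: "'a set"
    and E :: "('a \<Rightarrow> real) set"
  assumes "compact_space X" and "Hausdorff_space X"
    and "uniform_algebra X A"
    and "is_Silov_boundary X A S"
    and "E = C_topology (subtopology X S) closure_of Re_restriction A S"
  shows "C_rich (subtopology X S) E"
proof -
  let ?K = "subtopology X S"
  have Sc: "closedin X S"
    using assms(4) by (simp add: is_Silov_boundary_def)
  have ts: "topspace ?K = S"
    using closedin_subset[OF Sc] by auto
  have cs: "compact_space ?K"
    using assms(1) Sc by (simp add: closedin_compact_space compact_space_subtopology)
  have sub: "C_subspace ?K (Re_restriction A S)"
    using C_subspace_Re_restriction[OF assms(1) Sc] assms(3) unfolding uniform_algebra_def by blast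
  have RE: "Re_restriction A S \<subseteq> E"
    unfolding assms(5) using sub by (intro closure_of_subset) (simp add: C_subspace_def)
  show ?thesis
    unfolding C_rich_def
  proof (intro conjI allI impI)
    show "C_subspace ?K E"
      unfolding assms(5) by (rule C_subspace_closure_of[OF cs sub])
    show "closedin (C_topology ?K) E"
      unfolding assms(5) by (rule closedin_closure_of)
  next
    fix U and \<epsilon> :: real
    assume U: "openin ?K U \<and> U \<noteq> {} \<and> 0 < \<epsilon>"
    \<comment> \<open>Truncation and approximation in the algebra each cost \<open>\<eta>\<close>.\<close>
    define \<eta> where "\<eta> = min (\<epsilon> / 3) (1 / 2)"
    have \<eta>: "0 < \<eta>" "\<eta> < 1" "2 * \<eta> < \<epsilon>"
      using U by (auto simp: \<eta>_def)
    obtain u a p where u: "continuous_map ?K euclideanreal u" and a: "a \<in> S" "u a = 1"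
      and u01: "\<And>x. x \<in> S \<Longrightarrow> 0 \<le> u x \<and> u x \<le> 1"
      and usmall: "\<And>x. x \<in> S - U \<Longrightarrow> u x < \<eta>"
      and p: "p \<in> A" "\<And>x. x \<in> S \<Longrightarrow> \<bar>u x - Re (p x)\<bar> < \<eta>"
      using Silov_boundary_nonneg_peak[OF assms(1,3,4), of U \<eta>] U \<eta>(1) by blast
    define h where "h = (\<lambda>x\<in>S. max 0 (u x - \<eta>) / (1 - \<eta>))"
    have "continuous_map ?K euclideanreal ((\<lambda>t. max 0 (t - \<eta>) / (1 - \<eta>)) \<circ> u)"
      using \<eta> by (intro continuous_map_compose[OF u]) (auto intro!: continuous_intros)
    from C_spaceI[OF cs this] have hC: "h \<in> C_space ?K"
      unfolding h_def ts by (simp only: o_def)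
    have h: "0 \<le> h x" "h x \<le> 1" "\<bar>h x - u x\<bar> \<le> \<eta>" if "x \<in> S" for x
      using truncation[of "u x" \<eta>] u01[OF that] \<eta> that by (simp_all add: h_def)
    \<comment> \<open>Truncating at the level \<open>\<eta>\<close> leaves a closed set between the support and \<open>U\<close>.\<close>
    have "closedin ?K {x \<in> topspace ?K. u x \<in> {\<eta>..}}"
      by (rule closedin_continuous_map_preimage[OF u]) auto
    moreover have "{x \<in> topspace ?K. h x \<noteq> 0} \<subseteq> {x \<in> topspace ?K. u x \<in> {\<eta>..}}"
      by (auto simp: h_def max_def split: if_splits)
    ultimately have "C_support ?K h \<subseteq> {x \<in> topspace ?K. u x \<in> {\<eta>..}}"
      unfolding C_support_def by (intro closure_of_minimal)
    also have "\<dots> \<subseteq> U"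
      using usmall ts by force
    finally have supp: "C_support ?K h \<subseteq> U" .
    have norm: "sup_norm ?K h = 1"
    proof (rule sup_norm_eqI)
      show "a \<in> topspace ?K" using a ts by simp
      show "norm (h a) = 1" using a \<eta> by (simp add: h_def)
      show "norm (h y) \<le> 1" if "y \<in> topspace ?K" for y
        using h[of y] that ts by simp
    qed
    have "(\<lambda>x\<in>S. Re (p x)) \<in> E"
      using RE p(1) unfolding Re_restriction_def by blast
    then have "C_dist ?K (\<lambda>x\<in>topspace ?K. of_real (h x)) E \<le> 2 * \<eta>"
    proof (rule C_dist_le)
      show "dist ((\<lambda>x\<in>topspace ?K. of_real (h x)) x) ((\<lambda>x\<in>S. Re (p x)) x) \<le> 2 * \<eta>"
        if "x \<in> topspace ?K" for x
        using h(3)[of x] p(2)[of x] that ts by (simp add: dist_real_def)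
    qed (use \<eta> in auto)
    then have "C_dist ?K (\<lambda>x\<in>topspace ?K. of_real (h x)) E < \<epsilon>"
      using \<eta> by linarith
    moreover have "\<forall>x\<in>topspace ?K. 0 \<le> h x"
      using h(1) ts by simp
    ultimately
    show "\<exists>h. h \<in> C_space ?K \<and> (\<forall>x\<in>topspace ?K. 0 \<le> h x) \<and> sup_norm ?K h = 1 \<and>
        C_support ?K h \<subseteq> U \<and> C_dist ?K (\<lambda>x\<in>topspace ?K. of_real (h x)) E < \<epsilon>"
      using hC norm supp by (intro exI[of _ h] conjI)
  qed
qed

end
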